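(* Let $p$ be a prime with $p\equiv 15$ or $27\pmod{28}$. For all integers $n,k\geq 0$ with $p\nmid n$, \[ c_{9,5}\left(8p^{2k+1}n+\frac{34p^{2k+2}+1}{7}\right)\equiv 0\pmod 2. \]
   Context: For complex $a,b$ the false theta function is $\Psi(a,b):=\sum_{n=0}^\infty a^{n(n+1)/2}b^{n(n-1)/2}-\sum_{n=-\infty}^{-1}a^{n(n+1)/2}b^{n(n-1)/2}$. For positive integers $r,s$, the integers $c_{r,s}(n)$ ($n\ge 0$) are defined by the power series identity $\sum_{n=0}^\infty c_{r,s}(n)q^n=\dfrac{1}{\Psi(-q^r,q^s)}$ (the denominator is a power series in $q$ with constant term $1$). *)

theory Defs
  imports
    "HOL-Computational_Algebra.Formal_Power_Series"
    "HOL-Number_Theory.Cong"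
begin

text \<open>
  The false theta function is polymorphic: \<open>'a = complex\<close> gives the analytic function, and
  \<open>'a = int fps\<close>, where convergence is the \<open>q\<close>-adic one, gives the formal power series that
  defines the coefficients \<open>recip_coeff r s\<close>. The exponents \<open>n (n + 1) / 2\<close> and \<open>n (n - 1) / 2\<close> are
  nonnegative integers for every integer \<open>n\<close>, so \<open>div\<close> and \<open>nat\<close> lose nothing.
\<close>

definition false_theta_term :: "'a::comm_ring_1 \<Rightarrow> 'a \<Rightarrow> int \<Rightarrow> 'a" where
  "false_theta_term a b n = a ^ nat (n * (n + 1) div 2) * b ^ nat (n * (n - 1) div 2)"

text \<open>The index \<open>- int m - 1\<close> runs through the negative integers \<open>-1, -2, \<dots>\<close>.\<close>

definition false_theta :: "'a::{comm_ring_1,t2_space} \<Rightarrow> 'a \<Rightarrow> 'a" where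
  "false_theta a b =
     (\<Sum>m. false_theta_term a b (int m)) - (\<Sum>m. false_theta_term a b (- int m - 1))"

text \<open>
  Meaningful for positive \<open>r\<close> and \<open>s\<close>; existence and uniqueness of the sequence are
  \<open>recip_coeff_unique\<close> below.
\<close>

definition recip_coeff :: "nat \<Rightarrow> nat \<Rightarrow> nat \<Rightarrow> int" where
  "recip_coeff r s = (THE f. Abs_fps f * false_theta (- (fps_X ^ r)) (fps_X ^ s) = 1)"


lemma fps_sums_triangular:
  fixes f :: "nat \<Rightarrow> 'a::comm_ring_1 fps"
  assumes "\<And>k m. m < k \<Longrightarrow> fps_nth (f k) m = 0"
  shows "f sums Abs_fps (\<lambda>m. \<Sum>k\<le>m. fps_nth (f k) m)"
  unfolding sums_def
proof (rule tendsto_fpsI)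
  fix m
  show "\<forall>\<^sub>F n in sequentially. fps_nth (\<Sum>k<n. f k) m
          = fps_nth (Abs_fps (\<lambda>m. \<Sum>k\<le>m. fps_nth (f k) m)) m"
  proof (rule eventually_sequentiallyI[of "Suc m"])
    fix n assume "Suc m \<le> n"
    then have "(\<Sum>k<n. fps_nth (f k) m) = (\<Sum>k\<le>m. fps_nth (f k) m)"
      by (intro sum.mono_neutral_right) (auto simp: assms)
    then show "fps_nth (\<Sum>k<n. f k) m
          = fps_nth (Abs_fps (\<lambda>m. \<Sum>k\<le>m. fps_nth (f k) m)) m"
      by (simp add: fps_sum_nth)
  qed
qed

lemma false_theta_term_fps_nth:
  "fps_nth (false_theta_term (- (fps_X ^ r)) (fps_X ^ s) n :: int fps) m =
     (if m = r * nat (n * (n + 1) div 2) + s * nat (n * (n - 1) div 2)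
      then (- 1) ^ nat (n * (n + 1) div 2) else 0)"
proof -
  have *: "(- (fps_X ^ r)) ^ e * (fps_X ^ s :: int fps) ^ e' = fps_const ((- 1) ^ e) * fps_X ^ (r * e + s * e')"
    for e e' :: nat
  proof -
    have "(- (fps_X ^ r)) ^ e = fps_const ((- 1) ^ e) * (fps_X ^ r :: int fps) ^ e"
      by (cases "even e") (simp_all flip: fps_const_neg)
    then show ?thesis
      by (simp only: power_mult power_add mult.assoc)
  qed
  show ?thesis
    unfolding false_theta_term_def * by (auto simp: fps_X_power_nth)
qed

lemma false_theta_fps_sums:
  assumes "r > 0" "s > 0"
  defines "T \<equiv> false_theta_term (- (fps_X ^ r)) (fps_X ^ s) :: int \<Rightarrow> int fps"
  shows "(\<lambda>m. T (int m)) sums Abs_fps (\<lambda>m. \<Sum>k\<le>m. fps_nth (T (int k)) m)"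
    and "(\<lambda>m. T (- int m - 1)) sums Abs_fps (\<lambda>m. \<Sum>k\<le>m. fps_nth (T (- int k - 1)) m)"
proof -
  have tri: "int k \<le> int k * (int k + 1) div 2" for k
  proof -
    have "int k * 2 \<le> int k * (int k + 1)"
      by (cases "k = 0") (auto intro!: mult_left_mono)
    then show ?thesis by linarith
  qed
  have le: "k \<le> r * e + x" "k \<le> x + s * e" if "k \<le> e" for k e x
  proof -
    have "e \<le> r * e" "e \<le> s * e"
      using assms by auto
    then show "k \<le> r * e + x" "k \<le> x + s * e"
      using that by linarith+
  qed
  show "(\<lambda>m. T (int m)) sums Abs_fps (\<lambda>m. \<Sum>k\<le>m. fps_nth (T (int k)) m)"
  proof (rule fps_sums_triangular)
    fix k m :: nat assume "m < k"
    moreover have "k \<le> nat (int k * (int k + 1) div 2)"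
      using tri[of k] by linarith
    ultimately show "fps_nth (T (int k)) m = 0"
      using le(1) unfolding T_def false_theta_term_fps_nth by (metis leD)
  qed
  show "(\<lambda>m. T (- int m - 1)) sums Abs_fps (\<lambda>m. \<Sum>k\<le>m. fps_nth (T (- int k - 1)) m)"
  proof (rule fps_sums_triangular)
    fix k m :: nat assume "m < k"
    moreover have "(- int k - 1) * (- int k - 1 - 1) = int (Suc k) * (int (Suc k) + 1)"
      by (simp add: algebra_simps)
    then have "k \<le> nat ((- int k - 1) * (- int k - 1 - 1) div 2)"
      using tri[of "Suc k"] by linarith
    ultimately show "fps_nth (T (- int k - 1)) m = 0"
      using le(2) unfolding T_def false_theta_term_fps_nth by (metis leD)
  qed
qed

lemma false_theta_fps_nth:
  assumes "r > 0" "s > 0"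
  shows "fps_nth (false_theta (- (fps_X ^ r)) (fps_X ^ s) :: int fps) m =
    (\<Sum>k\<le>m. fps_nth (false_theta_term (- (fps_X ^ r)) (fps_X ^ s) (int k)) m) -
    (\<Sum>k\<le>m. fps_nth (false_theta_term (- (fps_X ^ r)) (fps_X ^ s) (- int k - 1)) m)"
  unfolding false_theta_def false_theta_fps_sums[OF assms, THEN sums_unique, symmetric]
  by simp

lemma false_theta_fps_nth_0:
  assumes "r > 0" "s > 0"
  shows "fps_nth (false_theta (- (fps_X ^ r)) (fps_X ^ s) :: int fps) 0 = 1"
  using assms by (simp add: false_theta_fps_nth false_theta_term_fps_nth)

lemma recip_coeff_unique:
  assumes "r > 0" "s > 0"
  shows "\<exists>!f. Abs_fps f * false_theta (- (fps_X ^ r)) (fps_X ^ s) = (1 :: int fps)"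
proof -
  define P :: "int fps" where "P = false_theta (- (fps_X ^ r)) (fps_X ^ s)"
  have P0: "fps_nth P 0 = 1"
    unfolding P_def using false_theta_fps_nth_0[OF assms] .
  then have *: "P * fps_right_inverse P 1 = 1"
    by (intro fps_right_inverse) simp
  show ?thesis
    unfolding P_def[symmetric]
  proof (rule ex1I)
    show "Abs_fps (fps_nth (fps_right_inverse P 1)) * P = 1"
      using * by (simp add: fps_nth_inverse mult.commute)
  next
    fix f assume "Abs_fps f * P = 1"
    then have "Abs_fps f = fps_right_inverse P 1"
      using * by (metis mult.assoc mult.left_neutral mult.right_neutral)
    then show "f = fps_nth (fps_right_inverse P 1)"
      by (metis fps_nth_Abs_fps ext)
  qed
qed

lemma recip_coeff_generating_function:
  assumes "r > 0" "s > 0"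
  shows "Abs_fps (recip_coeff r s) * false_theta (- (fps_X ^ r)) (fps_X ^ s) = 1"
  unfolding recip_coeff_def by (rule theI'[OF recip_coeff_unique[OF assms]])

text \<open>The division by 7 in the argument of \<open>recip_coeff\<close> is exact for the primes in question.\<close>

lemma seven_dvd_index:
  fixes p k :: nat
  assumes "p mod 28 = 15 \<or> p mod 28 = 27"
  shows "7 dvd 34 * p ^ (2 * k + 2) + 1"
proof -
  have "p mod 7 = (p mod 28) mod 7"
    by (simp add: mod_mod_cancel)
  then have "p mod 7 = 1 \<or> p mod 7 = 6"
    using assms by auto
  then have "(p mod 7) ^ 2 mod 7 = 1"
    by auto
  then have "p ^ 2 mod 7 = 1"
    by (simp add: power_mod)
  then have "(p ^ 2) ^ (k + 1) mod 7 = 1"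
    by (metis mod_mod_trivial power_mod power_one)
  moreover have "(p ^ 2) ^ (k + 1) = p ^ (2 * k + 2)"
    by (simp only: flip: power_mult) simp
  ultimately have "p ^ (2 * k + 2) mod 7 = 1"
    by simp
  then show ?thesis
    by presburger
qed

end

(*
  Modulo 2 the false theta series is G = sum q^(7n^2+2n), summed over all integers n, since signs
  do not matter. As squaring is X -> X^2 on series with coefficients in the field of two elements,
  1/G = G^7/G^8 is G(q) G(q^2) G(q^4) / G(q^8), so the coefficients of 1/G in the class 5 modulo 8
  come from those of G(q) G(q^2) G(q^4). A linear change of variables splits these off as
  G times sum q^(7t^2+t) times sum q^(7j^2-4j), and the factor G cancels. Hence c(8M+5) has the
  parity of the number of solutions of (14t+1)^2 + (14j-4)^2 = 28M+17. For the given index the right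
  side is divisible by p = 3 mod 4 exactly 2k+1 times, and such a number is not a sum of two squares.
*)
theory Submission
  imports
    Defs
    "HOL-Library.Z2"
    "HOL-Number_Theory.Residues"
begin

section \<open>Weight-counting series over the field of two elements\<close>

lemma odd_iff_of_int_bit: "odd n \<longleftrightarrow> (of_int n :: bit) = 1"
proof -
  have "(of_int (2 * k) :: bit) = 0" "(of_int (2 * k + 1) :: bit) = 1" for k
    by simp_all
  then show ?thesis
    by (metis evenE oddE zero_neq_one)
qed

text \<open>The series of all q^(w a), reduced modulo 2. It has this meaning only when
  \<open>w\<close> has finite fibres, since \<open>card\<close> is 0 on infinite sets; hence the
  finiteness assumptions below.\<close>

definition gf :: "('a \<Rightarrow> nat) \<Rightarrow> bit fps" where
  "gf w = Abs_fps (\<lambda>m. of_nat (card {a. w a = m}))"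

lemma card_fibre_add:
  fixes v :: "'a \<Rightarrow> nat" and w :: "'b \<Rightarrow> nat"
  assumes "\<And>m. finite {a. v a = m}" "\<And>m. finite {b. w b = m}"
  shows "finite {x. v (fst x) + w (snd x) = m}"
    and "card {x. v (fst x) + w (snd x) = m} = (\<Sum>i=0..m. card {a. v a = i} * card {b. w b = m - i})"
proof -
  have eq: "{x. v (fst x) + w (snd x) = m} = (\<Union>i\<in>{0..m}. {a. v a = i} \<times> {b. w b = m - i})"
    by auto
  show "finite {x. v (fst x) + w (snd x) = m}"
    unfolding eq using assms by auto
  show "card {x. v (fst x) + w (snd x) = m} = (\<Sum>i=0..m. card {a. v a = i} * card {b. w b = m - i})"
    unfolding eq by (subst card_UN_disjoint) (auto simp: assms card_cartesian_product)
qed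

lemma gf_mult:
  assumes "\<And>m. finite {a. v a = m}" "\<And>m. finite {b. w b = m}"
  shows "gf v * gf w = gf (\<lambda>x. v (fst x) + w (snd x))"
  by (rule fps_ext) (simp add: gf_def fps_mult_nth card_fibre_add(2)[OF assms])

lemma gf_mult3_nth:
  assumes "\<And>m. finite {a. u a = m}" "\<And>m. finite {b. v b = m}" "\<And>m. finite {c. w c = m}"
  shows "fps_nth (gf u * (gf v * gf w)) m = of_nat (card {(a, b, c). u a + (v b + w c) = m})"
  unfolding gf_mult[OF assms(2,3)] gf_mult[OF assms(1) card_fibre_add(1)[OF assms(2,3)]]
  by (simp add: gf_def case_prod_unfold)

text \<open>Swapping coordinates pairs off the off-diagonal pairs of equal total weight, so only the
  diagonal survives modulo 2. The linear order selects one member of each swapped pair.\<close>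

lemma gf_square:
  fixes w :: "'a::linorder \<Rightarrow> nat"
  assumes fin: "\<And>m. finite {a. w a = m}"
  shows "gf w ^ 2 = gf (\<lambda>a. 2 * w a)"
proof (rule fps_ext)
  fix m
  define P where "P = {x. w (fst x) + w (snd x) = m}"
  define L where "L = {x\<in>P. fst x < snd x}"
  define E where "E = {x\<in>P. fst x = snd x}"
  have "finite P"
    unfolding P_def by (rule card_fibre_add(1)[OF fin fin])
  then have finL: "finite L" "finite E"
    unfolding L_def E_def by auto
  have P: "P = E \<union> (L \<union> prod.swap ` L)"
  proof (intro equalityI subsetI)
    fix x assume "x \<in> P"
    then show "x \<in> E \<union> (L \<union> prod.swap ` L)"
      unfolding E_def L_def P_def image_def
      by (cases x) (auto simp: add.commute not_less_iff_gr_or_eq)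
  qed (auto simp: E_def L_def P_def)
  have "card P = card E + (card L + card (prod.swap ` L))"
    unfolding P using finL by (subst card_Un_disjoint, auto simp: E_def L_def)+
  also have "card (prod.swap ` L) = card L"
    by (rule card_image) (auto simp: inj_on_def)
  finally have "(of_nat (card P) :: bit) = of_nat (card E)"
    by (simp flip: mult_2)
  moreover have "bij_betw (\<lambda>a. (a, a)) {a. 2 * w a = m} E"
    by (auto simp: bij_betw_def inj_on_def E_def P_def)
  then have "card E = card {a. 2 * w a = m}"
    by (rule bij_betw_same_card[symmetric])
  ultimately show "fps_nth (gf w ^ 2) m = fps_nth (gf (\<lambda>a. 2 * w a)) m"
    unfolding power2_eq_square gf_mult[OF fin fin] by (simp add: gf_def P_def)
qed

section \<open>Quadratic exponents and the false theta series modulo 2\<close>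

definition quad_exp :: "int \<Rightarrow> int \<Rightarrow> nat" where
  "quad_exp c n = nat (7 * n\<^sup>2 + c * n)"

text \<open>Besides nonnegativity, which makes \<open>nat\<close> in \<open>quad_exp\<close>
  harmless, the bound confines the fibre over m to the interval from -m to m.\<close>

lemma abs_le_quadratic:
  fixes n c :: int
  assumes "\<bar>c\<bar> \<le> 6"
  shows "\<bar>n\<bar> \<le> 7 * n\<^sup>2 + c * n"
proof -
  have "\<bar>n\<bar> \<le> \<bar>n\<bar> * \<bar>n\<bar>"
    by (cases "n = 0") (use mult_right_mono[of 1 "\<bar>n\<bar>" "\<bar>n\<bar>"] in auto)
  then have "\<bar>n\<bar> \<le> n\<^sup>2"
    by (simp add: power2_eq_square)
  moreover have "\<bar>c * n\<bar> \<le> 6 * \<bar>n\<bar>"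
    using assms by (simp add: abs_mult mult_right_mono)
  ultimately show ?thesis
    by linarith
qed

lemma int_quad_exp:
  assumes "\<bar>c\<bar> \<le> 6"
  shows "int (quad_exp c n) = 7 * n\<^sup>2 + c * n"
  using abs_le_quadratic[OF assms, of n] by (simp add: quad_exp_def)

lemma finite_quad_exp_fibre:
  assumes "\<bar>c\<bar> \<le> 6"
  shows "finite {n. quad_exp c n = m}"
proof (rule finite_subset)
  show "{n. quad_exp c n = m} \<subseteq> {- int m..int m}"
    using abs_le_quadratic[OF assms] by (auto simp: abs_le_iff minus_le_iff simp flip: int_quad_exp[OF assms])
qed simp

text \<open>Modulo 2 both the powers of -1 and the minus sign before the second sum disappear, so
  the two half-sums merge into one sum over all integers.\<close>

lemma of_int_false_theta_nth:
  "of_int (fps_nth (false_theta (- (fps_X ^ 9)) (fps_X ^ 5)) m) = fps_nth (gf (quad_exp 2)) m"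
proof -
  let ?T = "\<lambda>n. fps_nth (false_theta_term (- (fps_X ^ 9)) (fps_X ^ 5) n :: int fps) m"
  have ex: "9 * nat (n * (n + 1) div 2) + 5 * nat (n * (n - 1) div 2) = quad_exp 2 n" for n :: int
  proof -
    \<comment> \<open>The two triangular exponents are h + n and h, and 9(h + n) + 5h = 14h + 9n,
      which is 7n^2 + 2n.\<close>
    define h where "h = n * (n - 1) div 2"
    have h: "n * (n - 1) = 2 * h"
      unfolding h_def by simp
    then have h': "n * (n + 1) div 2 = h + n"
      by (simp add: algebra_simps)
    have "0 \<le> n * (n - 1)" "0 \<le> n * (n + 1)"
      by (auto simp: zero_le_mult_iff)
    then have "0 \<le> h" "0 \<le> h + n"
      using h h' by (simp_all flip: h')
    moreover have "7 * n\<^sup>2 + 2 * n = 9 * (h + n) + 5 * h"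
      using h by (simp add: power2_eq_square algebra_simps)
    ultimately show ?thesis
      unfolding h' h_def[symmetric] quad_exp_def by simp
  qed
  have T: "(of_int (?T n) :: bit) = of_bool (quad_exp 2 n = m)" for n
    by (simp add: false_theta_term_fps_nth ex)
  let ?A = "{n. quad_exp 2 n = m}"
  have bnd: "\<bar>n\<bar> \<le> int m" if "quad_exp 2 n = m" for n
    using abs_le_quadratic[of 2 n] int_quad_exp[of 2 n] that by simp
  \<comment> \<open>The interval reaches one further to the left because the second sum starts at
    index -1; the extra index carries no term, by \<open>bnd\<close>.\<close>
  have split: "{- int m - 1..int m} = int ` {..m} \<union> (\<lambda>k. - int k - 1) ` {..m}"
  proof (intro equalityI subsetI)
    fix n assume n: "n \<in> {- int m - 1..int m}"
    show "n \<in> int ` {..m} \<union> (\<lambda>k. - int k - 1) ` {..m}"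
    proof (cases "n \<ge> 0")
      case True
      then have "n = int (nat n)" "nat n \<in> {..m}" using n by auto
      then show ?thesis by blast
    next
      case False
      then have "n = - int (nat (- n - 1)) - 1" "nat (- n - 1) \<in> {..m}" using n by auto
      then show ?thesis by blast
    qed
  qed auto
  have "(of_nat (card ?A) :: bit) = (\<Sum>n\<in>{- int m - 1..int m}. of_bool (quad_exp 2 n = m))"
  proof -
    have "{- int m - 1..int m} \<inter> ?A = ?A"
      using bnd by fastforce
    then show ?thesis
      by (simp add: sum.If_cases of_bool_def)
  qed
  also have "\<dots> = (\<Sum>k\<le>m. of_bool (quad_exp 2 (int k) = m)) + (\<Sum>k\<le>m. of_bool (quad_exp 2 (- int k - 1) = m))"
    unfolding split
    by (subst sum.union_disjoint) (force simp: sum.reindex inj_on_def simp del: add_bit_eq_xor sum_of_bool_eq)+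
  finally show ?thesis
    by (simp add: false_theta_fps_nth T gf_def)
qed

lemma recip_gf: "Abs_fps (\<lambda>m. of_int (recip_coeff 9 5 m)) * gf (quad_exp 2) = 1"
proof (rule fps_ext)
  fix m
  have "of_int (fps_nth (Abs_fps (recip_coeff 9 5) * false_theta (- (fps_X ^ 9)) (fps_X ^ 5)) m)
      = (of_int (fps_nth 1 m) :: bit)"
    by (simp only: recip_coeff_generating_function)
  then show "fps_nth (Abs_fps (\<lambda>m. of_int (recip_coeff 9 5 m)) * gf (quad_exp 2)) m = fps_nth 1 m"
    by (simp add: fps_mult_nth of_int_false_theta_nth[symmetric] del: minus_bit_def)
qed

section \<open>Dissection modulo 8\<close>

text \<open>\<open>B'\<close> is B(q^d), and multiplying by a series in q^d preserves residue
  classes of exponents modulo d. Extracting the class of r therefore passes through this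
  factor.\<close>

lemma fps_mult_dissect:
  fixes A B B' :: "'a::comm_ring_1 fps"
  assumes r: "r < d" and B': "\<And>k. fps_nth B' k = (if d dvd k then fps_nth B (k div d) else 0)"
  shows "fps_nth (A * B') (d * M + r) = fps_nth (Abs_fps (\<lambda>m. fps_nth A (d * m + r)) * B) M"
proof -
  have "fps_nth (B' * A) (d * M + r) = (\<Sum>i\<in>(*) d ` {0..M}. fps_nth B' i * fps_nth A (d * M + r - i))"
    unfolding fps_mult_nth
  proof (rule sum.mono_neutral_right)
    show "\<forall>i\<in>{0..d * M + r} - (*) d ` {0..M}. fps_nth B' i * fps_nth A (d * M + r - i) = 0"
    proof
      fix i assume i: "i \<in> {0..d * M + r} - (*) d ` {0..M}"
      have "\<not> d dvd i"
      proof
        assume "d dvd i"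
        then obtain j where j: "i = d * j" ..
        \<comment> \<open>As r < d, no multiple of d lies strictly between d M and d M + r +
          1.\<close>
        have "d * j < d * Suc M"
          using i j r by simp
        then have "j < Suc M"
          by (simp only: mult_less_cancel1)
        then have "j \<in> {0..M}"
          by simp
        then show False
          using i j by blast
      qed
      then show "fps_nth B' i * fps_nth A (d * M + r - i) = 0"
        by (simp add: B')
    qed
  qed (auto intro!: trans_le_add1)
  also have "\<dots> = (\<Sum>j=0..M. fps_nth B j * fps_nth A (d * (M - j) + r))"
  proof (subst sum.reindex)
    show "inj_on ((*) d) {0..M}"
      using r by (auto simp: inj_on_def)
    show "sum ((\<lambda>i. fps_nth B' i * fps_nth A (d * M + r - i)) \<circ> (*) d) {0..M} =
        (\<Sum>j=0..M. fps_nth B j * fps_nth A (d * (M - j) + r))"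
    proof (rule sum.cong)
      fix j assume "j \<in> {0..M}"
      then have "d * M + r - d * j = d * (M - j) + r"
        by (simp add: diff_mult_distrib2)
      then show "((\<lambda>i. fps_nth B' i * fps_nth A (d * M + r - i)) \<circ> (*) d) j =
          fps_nth B j * fps_nth A (d * (M - j) + r)"
        using r by (simp add: B')
    qed simp
  qed
  finally show ?thesis
    by (simp add: fps_mult_nth mult.commute[of _ B] mult.commute[of _ B'])
qed

text \<open>The cross terms cancel because (j - i)^2 + (i + j)^2 = 2 i^2 + 2 j^2; the variable t
  stays separate.\<close>

lemma quad_exp_dissect:
  "quad_exp 2 (2 * (j - i) - 1) + (2 * quad_exp 2 (2 * t) + 4 * quad_exp 2 (- (i + j))) =
    8 * (quad_exp 2 i + (quad_exp 1 t + quad_exp (-4) j)) + 5"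
proof -
  have "int (quad_exp 2 (2 * (j - i) - 1) + (2 * quad_exp 2 (2 * t) + 4 * quad_exp 2 (- (i + j)))) =
      int (8 * (quad_exp 2 i + (quad_exp 1 t + quad_exp (-4) j)) + 5)"
    by (simp add: int_quad_exp power2_eq_square algebra_simps)
  then show ?thesis
    by (simp only: of_nat_eq_iff)
qed

text \<open>Parity is read off three times, halving the equation in between: first a is odd, then b
  is even, then a' and c have equal parity, where a = 2a' - 1.\<close>

lemma quad_exp_dissect_residues:
  assumes "quad_exp 2 a + (2 * quad_exp 2 b + 4 * quad_exp 2 c) = 8 * M + 5"
  obtains i t j where "a = 2 * (j - i) - 1" "b = 2 * t" "c = - (i + j)"
proof -
  have "int (quad_exp 2 a + (2 * quad_exp 2 b + 4 * quad_exp 2 c)) = int (8 * M + 5)"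
    using assms by (simp only:)
  then have eq: "7 * a\<^sup>2 + 2 * a + (2 * (7 * b\<^sup>2 + 2 * b) + 4 * (7 * c\<^sup>2 + 2 * c)) = 8 * int M + 5"
    by (simp add: int_quad_exp)
  have "odd (7 * a\<^sup>2 + 2 * a + (2 * (7 * b\<^sup>2 + 2 * b) + 4 * (7 * c\<^sup>2 + 2 * c)))"
    unfolding eq by simp
  then have "odd a"
    by simp
  then obtain a' where a': "a = 2 * a' - 1"
    by (metis add_diff_cancel_right' diff_add_cancel mult.commute oddE odd_add odd_one evenE)
  have eq': "14 * a'\<^sup>2 - 12 * a' + 7 * b\<^sup>2 + 2 * b + 2 * (7 * c\<^sup>2 + 2 * c) = 4 * int M"
    using eq unfolding a' by (simp add: power2_eq_square algebra_simps)
  have "even (14 * a'\<^sup>2 - 12 * a' + 7 * b\<^sup>2 + 2 * b + 2 * (7 * c\<^sup>2 + 2 * c))"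
    unfolding eq' by simp
  then have "even b"
    by simp
  then obtain t where t: "b = 2 * t" ..
  have eq'': "7 * a'\<^sup>2 - 6 * a' + 14 * t\<^sup>2 + 2 * t + (7 * c\<^sup>2 + 2 * c) = 2 * int M"
    using eq' unfolding t by (simp add: power2_eq_square algebra_simps)
  have "even (7 * a'\<^sup>2 - 6 * a' + 14 * t\<^sup>2 + 2 * t + (7 * c\<^sup>2 + 2 * c))"
    unfolding eq'' by simp
  then have "even (a' - c)"
    by simp
  then obtain j where j: "a' - c = 2 * j" ..
  show ?thesis
  proof (rule that)
    \<comment> \<open>The witness for i is j - a', forced by a' = j - i.\<close>
    show "a = 2 * (j - (j - a')) - 1" "b = 2 * t" "c = - ((j - a') + j)"
      using a' t j by simp_all
  qed
qed

lemma card_quad_exp_dissect: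
  "card {(a, b, c). quad_exp 2 a + (2 * quad_exp 2 b + 4 * quad_exp 2 c) = 8 * M + 5} =
    card {(i, t, j). quad_exp 2 i + (quad_exp 1 t + quad_exp (-4) j) = M}" (is "card ?A = card ?B")
proof -
  let ?f = "\<lambda>(i, t, j). (2 * (j - i) - 1, 2 * t, - (i + j)) :: int \<times> int \<times> int"
  have "bij_betw ?f ?B ?A"
  proof (rule bij_betw_imageI)
    show "inj_on ?f ?B"
      by (auto simp: inj_on_def)
    show "?f ` ?B = ?A"
    proof (intro equalityI subsetI)
      fix x assume x: "x \<in> ?A"
      obtain a b c where abc: "x = (a, b, c)"
        by (cases x)
      with x have eq: "quad_exp 2 a + (2 * quad_exp 2 b + 4 * quad_exp 2 c) = 8 * M + 5"
        by simp
      then obtain i t j where ijt: "a = 2 * (j - i) - 1" "b = 2 * t" "c = - (i + j)"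
        by (rule quad_exp_dissect_residues)
      have "(i, t, j) \<in> ?B"
        using eq unfolding ijt quad_exp_dissect by simp
      moreover have "x = ?f (i, t, j)"
        by (simp add: abc ijt)
      ultimately show "x \<in> ?f ` ?B"
        by blast
    next
      fix x assume "x \<in> ?f ` ?B"
      then obtain z where z: "z \<in> ?B" "x = ?f z"
        by blast
      obtain i t j where "z = (i, t, j)"
        by (cases z)
      with z show "x \<in> ?A"
        using quad_exp_dissect[of j i t] by simp
    qed
  qed
  then show ?thesis
    by (rule bij_betw_same_card[symmetric])
qed

lemma finite_fibre_scale:
  fixes w :: "'a \<Rightarrow> nat"
  assumes "\<And>m. finite {a. w a = m}" "d > 0"
  shows "finite {a. d * w a = m}"
  by (rule finite_subset[OF _ assms(1)[of "m div d"]]) (use assms(2) in auto)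

lemma recip_coeff_dissect_gf:
  "Abs_fps (\<lambda>m. of_int (recip_coeff 9 5 (8 * m + 5))) = gf (quad_exp 1) * gf (quad_exp (-4))"
proof -
  define C :: "bit fps" where "C = Abs_fps (\<lambda>m. of_int (recip_coeff 9 5 m))"
  define G where "G = gf (quad_exp 2)"
  define D where "D = Abs_fps (\<lambda>m. fps_nth C (8 * m + 5))"
  define H where "H = gf (quad_exp 1) * gf (quad_exp (-4))"
  have fin: "finite {n. quad_exp 2 n = m}" "finite {n. quad_exp 1 n = m}"
    "finite {n. quad_exp (-4) n = m}" for m
    by (simp_all add: finite_quad_exp_fibre)
  note fin_scale = finite_fibre_scale[OF fin(1)]
  have CG: "C * G = 1"
    unfolding C_def G_def by (rule recip_gf)
  have G2: "G ^ 2 = gf (\<lambda>n. 2 * quad_exp 2 n)"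
    unfolding G_def by (rule gf_square[OF fin(1)])
  have "(G ^ 2) ^ 2 = gf (\<lambda>n. 2 * (2 * quad_exp 2 n))"
    unfolding G2 by (rule gf_square) (simp add: fin_scale)
  then have G4: "G ^ 4 = gf (\<lambda>n. 4 * quad_exp 2 n)"
    by (simp flip: power_mult)
  have "(G ^ 4) ^ 2 = gf (\<lambda>n. 2 * (4 * quad_exp 2 n))"
    unfolding G4 by (rule gf_square) (simp add: fin_scale)
  then have G8: "G ^ 8 = gf (\<lambda>n. 8 * quad_exp 2 n)"
    by (simp flip: power_mult)
  \<comment> \<open>Working with G^8, a series in q^8, avoids division: one factor G cancels against
    C and the other seven form G G^2 G^4.\<close>
  have "C * G ^ 8 = (C * G) * (G * (G ^ 2 * G ^ 4))"
    by (simp add: algebra_simps eval_nat_numeral)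
  then have CG8: "C * G ^ 8 = G * (G ^ 2 * G ^ 4)"
    by (simp add: CG)
  have "D * G = G * H"
  proof (rule fps_ext)
    fix M
    have "fps_nth (D * G) M = fps_nth (C * G ^ 8) (8 * M + 5)"
      unfolding D_def
    proof (rule fps_mult_dissect[symmetric])
      fix k
      show "fps_nth (G ^ 8) k = (if 8 dvd k then fps_nth G (k div 8) else 0)"
      proof (cases "8 dvd k")
        case True
        then show ?thesis
          unfolding G8 unfolding G_def gf_def by auto
      next
        case False
        then have "{n. 8 * quad_exp 2 n = k} = {}"
          by auto
        with False show ?thesis
          unfolding G8 by (simp add: gf_def)
      qed
    qed simp
    also have "\<dots> = of_nat (card {(a, b, c). quad_exp 2 a + (2 * quad_exp 2 b + 4 * quad_exp 2 c) = 8 * M + 5})"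
      unfolding CG8 G2 G4 unfolding G_def
      by (rule gf_mult3_nth) (simp_all add: fin fin_scale)
    also have "\<dots> = fps_nth (G * H) M"
      unfolding card_quad_exp_dissect H_def G_def
      by (rule gf_mult3_nth[symmetric]) (simp_all add: fin)
    finally show "fps_nth (D * G) M = fps_nth (G * H) M" .
  qed
  \<comment> \<open>Power series over a field form an integral domain, so a nonzero G can be
    cancelled.\<close>
  moreover have "G \<noteq> 0"
    using CG by auto
  ultimately have "D = H"
    by (simp add: mult.commute[of G])
  then show ?thesis
    by (simp add: D_def C_def H_def)
qed

section \<open>Sums of two squares\<close>

lemma even_recip_coeff_if_no_rep:
  assumes "\<And>x y :: int. x\<^sup>2 + y\<^sup>2 \<noteq> 28 * int M + 17"
  shows "even (recip_coeff 9 5 (8 * M + 5))"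
proof -
  have "{x. quad_exp 1 (fst x) + quad_exp (-4) (snd x) = M} = {}"
  proof (intro equals0I)
    fix x assume "x \<in> {x. quad_exp 1 (fst x) + quad_exp (-4) (snd x) = M}"
    then have "int (quad_exp 1 (fst x)) + int (quad_exp (-4) (snd x)) = int M"
      by (simp flip: of_nat_add)
    \<comment> \<open>Multiplication by 28 completes both squares: 28(7t^2 + t) = (14t + 1)^2 - 1
      and 28(7j^2 - 4j) = (14j - 4)^2 - 16.\<close>
    then have "(14 * fst x + 1)\<^sup>2 + (14 * snd x - 4)\<^sup>2 = 28 * int M + 17"
      by (simp add: int_quad_exp power2_eq_square algebra_simps)
    then show False
      using assms by blast
  qed
  then have "fps_nth (gf (quad_exp 1) * gf (quad_exp (-4))) M = 0"
    by (subst gf_mult) (simp_all add: finite_quad_exp_fibre gf_def)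
  then have "(of_int (recip_coeff 9 5 (8 * M + 5)) :: bit) = 0"
    unfolding recip_coeff_dissect_gf[symmetric] by simp
  then show ?thesis
    by (metis odd_iff_of_int_bit zero_neq_one)
qed

text \<open>Otherwise p divides neither a nor b. Raising a^2 = -b^2 modulo p to the odd power (p -
  1)/2 then gives 1 = -1 by Fermat's little theorem, impossible for p > 2.\<close>

lemma prime_3_mod_4_dvd_sum_squares:
  fixes a b :: int
  assumes p: "prime p" "[p = 3] (mod 4)" and dvd: "int p dvd a\<^sup>2 + b\<^sup>2"
  shows "int p dvd a"
proof (rule ccontr)
  assume a: "\<not> int p dvd a"
  have prime: "prime (int p)"
    using p by simp
  have "p mod 4 = 3"
    using p(2) by (simp add: cong_def)
  define h where "h = (p - 1) div 2"
  have h: "p - 1 = 2 * h" "odd h"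
    using \<open>p mod 4 = 3\<close> unfolding h_def by presburger+
  have "\<not> int p dvd b"
  proof
    assume "int p dvd b"
    then have "int p dvd a\<^sup>2"
      using dvd by (simp add: dvd_add_left_iff power2_eq_square)
    then show False
      using a prime prime_dvd_power by blast
  qed
  have fermat: "[x ^ (p - 1) = 1] (mod int p)" if "\<not> int p dvd x" for x
  proof -
    \<comment> \<open>Fermat's theorem is applied to the natural number |x|; the sign is lost
      harmlessly, as the exponent p - 1 = 2h is even.\<close>
    have "\<not> p dvd nat \<bar>x\<bar>"
      using that by (simp add: int_dvd_int_iff[symmetric])
    then have "[int (nat \<bar>x\<bar> ^ (p - 1)) = int 1] (mod int p)"
      unfolding cong_int_iff using fermat_theorem p(1) by blast
    then show ?thesis
      unfolding h(1) by (simp add: power_mult)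
  qed
  have "[a\<^sup>2 = - (b\<^sup>2)] (mod int p)"
    using dvd by (simp add: cong_iff_dvd_diff)
  then have "[(a\<^sup>2) ^ h = (- (b\<^sup>2)) ^ h] (mod int p)"
    by (rule cong_pow)
  then have "[a ^ (p - 1) = - (b ^ (p - 1))] (mod int p)"
    using h by (simp add: power_mult power_minus_odd)
  moreover have "[- (b ^ (p - 1)) = - 1] (mod int p)"
    using fermat[OF \<open>\<not> int p dvd b\<close>] by (simp add: cong_minus_minus_iff)
  ultimately have "[1 = - 1] (mod int p)"
    using fermat[OF a] by (meson cong_sym cong_trans)
  then have "int p dvd 2"
    by (simp add: cong_iff_dvd_diff)
  then have "p \<le> 2"
    using zdvd_imp_le[of "int p" 2] by simp
  then show False
    using \<open>p mod 4 = 3\<close> prime_gt_1_nat[OF p(1)] by simp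
qed

text \<open>Descent: p divides x and y, so p^2 can be removed from both sides, lowering the exponent
  by 2. Once the exponent is 1, the same division leaves a factor p in m.\<close>

lemma sum_squares_odd_valuation:
  fixes x y m :: int
  assumes p: "prime p" "[p = 3] (mod 4)"
    and "x\<^sup>2 + y\<^sup>2 = int p ^ (2 * k + 1) * m"
  shows "int p dvd m"
proof -
  have "p > 0"
    using p(1) by (rule prime_gt_0_nat)
  have dvd: "int p dvd x \<and> int p dvd y" if "int p dvd x\<^sup>2 + y\<^sup>2" for x y
    using prime_3_mod_4_dvd_sum_squares[OF p] that by (metis add.commute)
  show ?thesis
    using assms(3)
  proof (induction k arbitrary: x y)
    case (0 x y)
    then have eq: "x\<^sup>2 + y\<^sup>2 = int p * m"
      by simp
    then have "int p dvd x" "int p dvd y"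
      using dvd[of x y] by auto
    then obtain u v where "x = int p * u" "y = int p * v"
      by (elim dvdE)
    with eq have "int p * (int p * (u\<^sup>2 + v\<^sup>2)) = int p * m"
      by (simp add: power2_eq_square algebra_simps)
    then have "int p * (u\<^sup>2 + v\<^sup>2) = m"
      using \<open>p > 0\<close> by simp
    then show ?case
      by (metis dvd_triv_left)
  next
    case (Suc k x y)
    then have eq: "x\<^sup>2 + y\<^sup>2 = int p * (int p * (int p ^ (2 * k + 1) * m))"
      by (simp add: algebra_simps)
    then have "int p dvd x" "int p dvd y"
      using dvd[of x y] by auto
    then obtain u v where "x = int p * u" "y = int p * v"
      by (elim dvdE)
    with eq have "int p * (int p * (u\<^sup>2 + v\<^sup>2)) = int p * (int p * (int p ^ (2 * k + 1) * m))"
      by (simp add: power2_eq_square algebra_simps)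
    then have "u\<^sup>2 + v\<^sup>2 = int p ^ (2 * k + 1) * m"
      using \<open>p > 0\<close> by simp
    then show ?case
      by (rule Suc.IH)
  qed
qed

theorem theorem6p3:
  fixes p n k :: nat
  assumes "prime p"
    and "[p = 15] (mod 28) \<or> [p = 27] (mod 28)"
    and "\<not> p dvd n"
  shows "[recip_coeff 9 5 (8 * p ^ (2 * k + 1) * n + (34 * p ^ (2 * k + 2) + 1) div 7) = 0] (mod 2)"
proof -
  have p28: "p mod 28 = 15 \<or> p mod 28 = 27"
    using assms(2) by (simp add: cong_def)
  then have p4: "[p = 3] (mod 4)"
    unfolding cong_def by presburger
  \<comment> \<open>Both 15 and 27 square to 1 modulo 28, which yields the quotient Q below.\<close>
  have "p\<^sup>2 mod 28 = (p mod 28)\<^sup>2 mod 28"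
    by (simp add: power_mod)
  then have "p\<^sup>2 mod 28 = 1"
    using p28 by auto
  then have "(p\<^sup>2) ^ (k + 1) mod 28 = 1"
    by (metis mod_mod_trivial power_mod power_one)
  moreover have "(p\<^sup>2) ^ (k + 1) = p ^ (2 * k + 2)"
    by (simp only: flip: power_mult) simp
  ultimately have "p ^ (2 * k + 2) mod 28 = 1"
    by simp
  then obtain Q where Q: "p ^ (2 * k + 2) = 28 * Q + 1"
    by (metis mult_div_mod_eq)
  \<comment> \<open>Substituting 28Q + 1 for the even power of p gives (34(28Q + 1) + 1)/7 = 8 * 17Q
    + 5.\<close>
  define M where "M = p ^ (2 * k + 1) * n + 17 * Q"
  have index: "8 * p ^ (2 * k + 1) * n + (34 * p ^ (2 * k + 2) + 1) div 7 = 8 * M + 5"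
    unfolding Q M_def by (simp add: algebra_simps)
  have "28 * M + 17 = 28 * (p ^ (2 * k + 1) * n) + 17 * p ^ (2 * k + 2)"
    unfolding Q M_def by simp
  then have M: "28 * M + 17 = p ^ (2 * k + 1) * (28 * n + 17 * p)"
    by (simp add: algebra_simps)
  \<comment> \<open>So p divides 28M + 17 to the exact odd power 2k + 1.\<close>
  have "\<not> p dvd 28 * n + 17 * p"
  proof
    assume "p dvd 28 * n + 17 * p"
    then have "p dvd 28 * n"
      by (simp add: dvd_add_left_iff)
    then have "p dvd 28"
      using assms(1,3) prime_dvd_mult_iff by blast
    then have "p \<le> 28"
      by (rule dvd_imp_le) simp
    \<comment> \<open>A prime p dividing 28 is at most 28, so its residue modulo 28 leaves only 15
      and 27, and neither divides 28.\<close>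
    then have "p = 15 \<or> p = 27"
      using p28 by (cases "p = 28") auto
    then show False
      using \<open>p dvd 28\<close> by auto
  qed
  then have ndvd: "\<not> int p dvd int (28 * n + 17 * p)"
    by (simp only: int_dvd_int_iff not_False_eq_True)
  have "even (recip_coeff 9 5 (8 * M + 5))"
  proof (rule even_recip_coeff_if_no_rep)
    fix x y :: int
    have "28 * int M + 17 = int p ^ (2 * k + 1) * int (28 * n + 17 * p)"
      using M by (simp flip: of_nat_power of_nat_mult of_nat_add)
    then show "x\<^sup>2 + y\<^sup>2 \<noteq> 28 * int M + 17"
      using sum_squares_odd_valuation[OF assms(1) p4] ndvd by metis
  qed
  then show ?thesis
    unfolding index by (simp add: cong_0_iff)
qed

end
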